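(* The set $\mathcal{R}_p(1)$, with the composition $\rho\rho':=\rho*\rho'$ taken modulo $\approx$, is a group isomorphic to the symmetric group $\mathrm{S}_4$.
   Context: Language: variables (including $e$), constants $0,1$, connectives $\neg,\vee$ (others as abbreviations), modal operator $\lozenge$. $\mathbf{E}$ is the smallest set of formulas containing all propositional tautologies and closed under modus ponens, uniform substitution and RE (from $\varphi\leftrightarrow\psi$ infer $\lozenge\varphi\leftrightarrow\lozenge\psi$). $\varphi\approx\psi$ means $\vdash_{\mathbf{E}}\varphi\leftrightarrow\psi$. A uniform replacement (UR) is a formula $\rho(e)$ of modal degree at most 1 in the single variable $e$. For any formula $\varphi$, $\varphi*\rho$ is defined recursively: $0*\rho=0$, $1*\rho=1$, variables are unchanged, $(\psi\vee\theta)*\rho=(\psi*\rho)\vee(\theta*\rho)$, $(\neg\psi)*\rho=\neg(\psi*\rho)$, $(\lozenge\psi)*\rho=\rho(\psi*\rho)$ (substitute $\psi*\rho$ for $e$ in $\rho(e)$). Composition: $\rho\rho':=\rho*\rho'$ (the UR $\rho'$ applied to the formula $\rho(e)$). $\mathcal{R}_p(1)$ is the set of 24 URs: all $\lambda\leftrightarrow\tau$ with $\lambda\in\{\lozenge e,\neg\lozenge e\}$ and $\tau\in\{1,e,e\vee\lozenge\neg e,e\vee\neg\lozenge\neg e,\neg e\vee\lozenge\neg e,\neg e\vee\neg\lozenge\neg e\}$, together with all $\lambda\leftrightarrow\tau$ with $\lambda\in\{\lozenge\neg e,\neg\lozenge\neg e\}$ and $\tau\in\{1,e,e\vee\lozenge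 e,e\vee\neg\lozenge e,\neg e\vee\lozenge e,\neg e\vee\neg\lozenge e\}$. *)

theory Defs
  imports "HOL-Algebra.Sym_Groups"
begin

datatype fm =
    Var nat
  | Zero
  | One
  | Neg fm
  | Or fm fm
  | Dia fm

abbreviation And :: "fm \<Rightarrow> fm \<Rightarrow> fm" where
  "And \<phi> \<psi> \<equiv> Neg (Or (Neg \<phi>) (Neg \<psi>))"

abbreviation Imp :: "fm \<Rightarrow> fm \<Rightarrow> fm" where
  "Imp \<phi> \<psi> \<equiv> Or (Neg \<phi>) \<psi>"

abbreviation Iff :: "fm \<Rightarrow> fm \<Rightarrow> fm" where
  "Iff \<phi> \<psi> \<equiv> And (Imp \<phi> \<psi>) (Imp \<psi> \<phi>)"

text \<open>The distinguished variable \<open>e\<close> is the variable with index 0.\<close>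

abbreviation e_idx :: nat where
  "e_idx \<equiv> 0"

abbreviation e :: fm where
  "e \<equiv> Var e_idx"

primrec vars :: "fm \<Rightarrow> nat set" where
  "vars (Var x) = {x}"
| "vars Zero = {}"
| "vars One = {}"
| "vars (Neg \<phi>) = vars \<phi>"
| "vars (Or \<phi> \<psi>) = vars \<phi> \<union> vars \<psi>"
| "vars (Dia \<phi>) = vars \<phi>"

primrec modal_degree :: "fm \<Rightarrow> nat" where
  "modal_degree (Var x) = 0"
| "modal_degree Zero = 0"
| "modal_degree One = 0"
| "modal_degree (Neg \<phi>) = modal_degree \<phi>"
| "modal_degree (Or \<phi> \<psi>) = max (modal_degree \<phi>) (modal_degree \<psi>)"
| "modal_degree (Dia \<phi>) = Suc (modal_degree \<phi>)"

primrec subst :: "(nat \<Rightarrow> fm) \<Rightarrow> fm \<Rightarrow> fm" where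
  "subst s (Var x) = s x"
| "subst s Zero = Zero"
| "subst s One = One"
| "subst s (Neg \<phi>) = Neg (subst s \<phi>)"
| "subst s (Or \<phi> \<psi>) = Or (subst s \<phi>) (subst s \<psi>)"
| "subst s (Dia \<phi>) = Dia (subst s \<phi>)"

text \<open>Propositional truth: variables and formulas of the form \<open>Dia \<phi>\<close> are the atoms.\<close>

primrec prop_eval :: "(fm \<Rightarrow> bool) \<Rightarrow> fm \<Rightarrow> bool" where
  "prop_eval v (Var x) \<longleftrightarrow> v (Var x)"
| "prop_eval v Zero \<longleftrightarrow> False"
| "prop_eval v One \<longleftrightarrow> True"
| "prop_eval v (Neg \<phi>) \<longleftrightarrow> \<not> prop_eval v \<phi>"
| "prop_eval v (Or \<phi> \<psi>) \<longleftrightarrow> prop_eval v \<phi> \<or> prop_eval v \<psi>"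
| "prop_eval v (Dia \<phi>) \<longleftrightarrow> v (Dia \<phi>)"

definition tautology :: "fm \<Rightarrow> bool" where
  "tautology \<phi> \<longleftrightarrow> (\<forall>v. prop_eval v \<phi>)"

inductive_set E :: "fm set" where
  taut: "tautology \<phi> \<Longrightarrow> \<phi> \<in> E"
| MP: "Imp \<phi> \<psi> \<in> E \<Longrightarrow> \<phi> \<in> E \<Longrightarrow> \<psi> \<in> E"
| US: "\<phi> \<in> E \<Longrightarrow> subst s \<phi> \<in> E"
| RE: "Iff \<phi> \<psi> \<in> E \<Longrightarrow> Iff (Dia \<phi>) (Dia \<psi>) \<in> E"

definition E_equiv :: "fm \<Rightarrow> fm \<Rightarrow> bool" (infix "\<approx>" 50) where
  "\<phi> \<approx> \<psi> \<longleftrightarrow> Iff \<phi> \<psi> \<in> E"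

definition UR :: "fm set" where
  "UR = {\<rho>. modal_degree \<rho> \<le> 1 \<and> vars \<rho> \<subseteq> {e_idx}}"

text \<open>\<open>inst \<rho> \<psi>\<close> is \<open>\<rho>(\<psi>)\<close>.\<close>

definition inst :: "fm \<Rightarrow> fm \<Rightarrow> fm" where
  "inst \<rho> \<psi> = subst (Var(e_idx := \<psi>)) \<rho>"

primrec star :: "fm \<Rightarrow> fm \<Rightarrow> fm" (infixl "\<star>" 75) where
  "Var x \<star> \<rho> = Var x"
| "Zero \<star> \<rho> = Zero"
| "One \<star> \<rho> = One"
| "Neg \<psi> \<star> \<rho> = Neg (\<psi> \<star> \<rho>)"
| "Or \<psi> \<theta> \<star> \<rho> = Or (\<psi> \<star> \<rho>) (\<theta> \<star> \<rho>)"
| "Dia \<psi> \<star> \<rho> = inst \<rho> (\<psi> \<star> \<rho>)"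

definition Rp1 :: "fm set" where
  "Rp1 =
    {Iff l t | l t.
       l \<in> {Dia e, Neg (Dia e)} \<and>
       t \<in> {One, e,
            Or e (Dia (Neg e)), Or e (Neg (Dia (Neg e))),
            Or (Neg e) (Dia (Neg e)), Or (Neg e) (Neg (Dia (Neg e)))}} \<union>
    {Iff l t | l t.
       l \<in> {Dia (Neg e), Neg (Dia (Neg e))} \<and>
       t \<in> {One, e,
            Or e (Dia e), Or e (Neg (Dia e)),
            Or (Neg e) (Dia e), Or (Neg e) (Neg (Dia e))}}"

definition UR_rel :: "(fm \<times> fm) set" where
  "UR_rel = {(\<rho>, \<sigma>). \<rho> \<in> UR \<and> \<sigma> \<in> UR \<and> \<rho> \<approx> \<sigma>}"

text \<open>
  The elements are the \<open>\<approx>\<close>-classes, among all uniform replacements, of the members of \<open>Rp1\<close>.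
  A product is the union of the classes of \<open>\<rho> \<star> \<rho>'\<close> over all representatives, so it is a
  single class of a member of \<open>Rp1\<close> only if composition respects \<open>\<approx>\<close> and \<open>Rp1\<close> is closed
  under it modulo \<open>\<approx>\<close>. The unit is the class of \<open>Dia e\<close>, since \<open>\<phi> \<star> Dia e = \<phi>\<close>.
\<close>

definition Rp1_group :: "fm set monoid" where
  "Rp1_group =
    \<lparr>carrier = Rp1 // UR_rel,
     mult = (\<lambda>A B. \<Union>\<rho>\<in>A. \<Union>\<rho>'\<in>B. UR_rel `` {\<rho> \<star> \<rho>'}),
     one = UR_rel `` {Dia e}\<rparr>"

lemma Rp1_subset_UR: "Rp1 \<subseteq> UR"
  by (auto simp: Rp1_def UR_def)

lemma card_Rp1: "card Rp1 = 24"
proof -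
  let ?I = "\<lambda>(l, t). Iff l t"
  let ?A = "{Dia e, Neg (Dia e)} \<times>
    {One, e, Or e (Dia (Neg e)), Or e (Neg (Dia (Neg e))),
     Or (Neg e) (Dia (Neg e)), Or (Neg e) (Neg (Dia (Neg e)))}"
  let ?B = "{Dia (Neg e), Neg (Dia (Neg e))} \<times>
    {One, e, Or e (Dia e), Or e (Neg (Dia e)),
     Or (Neg e) (Dia e), Or (Neg e) (Neg (Dia e))}"
  have "{Iff l t | l t. l \<in> L \<and> t \<in> T} = ?I ` (L \<times> T)" for L T
    by force
  then have eq: "Rp1 = ?I ` (?A \<union> ?B)"
    by (simp only: Rp1_def image_Un)
  have "inj_on ?I (?A \<union> ?B)"
    by (rule inj_onI) (simp add: case_prod_unfold prod_eq_iff)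
  moreover have "card (?A \<union> ?B) = 24"
    by (subst card_Un_disjoint) (auto simp: card_cartesian_product)
  ultimately show ?thesis
    unfolding eq by (simp only: card_image)
qed

end

theory Submission
  imports Defs "HOL-Library.Cardinality"
begin

text \<open>
  Interpret formulas in a neighbourhood model with two worlds \<open>True\<close> and \<open>False\<close>, the variable
  \<open>e\<close> being true exactly at \<open>True\<close>. A model symmetric under exchanging the worlds is
  given, up to the irrelevant neighbourhoods of \<open>0\<close> and \<open>1\<close>, by the truth set
  \<open>p\<close> of \<open>\<lozenge>e\<close>, and the truth set of a replacement \<open>\<rho>\<close> in it is again
  such a set. So \<open>\<rho>\<close> acts on the four subsets of the two worlds, and composition of
  replacements is composition of actions. Boolean combinations of \<open>e\<close>, \<open>\<lozenge>e\<close> and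
  \<open>\<lozenge>\<not>e\<close> are determined up to \<open>\<approx>\<close> by their actions, and the 24 members of
  \<open>Rp1\<close> act as distinct permutations, hence as all of them.
\<close>

section \<open>Neighbourhood semantics and soundness\<close>

primrec sem :: "(nat \<Rightarrow> 'w \<Rightarrow> bool) \<Rightarrow> (('w \<Rightarrow> bool) \<Rightarrow> 'w \<Rightarrow> bool) \<Rightarrow> fm \<Rightarrow> 'w \<Rightarrow> bool" where
  "sem V N (Var x) = V x"
| "sem V N Zero = (\<lambda>w. False)"
| "sem V N One = (\<lambda>w. True)"
| "sem V N (Neg \<phi>) = (\<lambda>w. \<not> sem V N \<phi> w)"
| "sem V N (Or \<phi> \<psi>) = (\<lambda>w. sem V N \<phi> w \<or> sem V N \<psi> w)"
| "sem V N (Dia \<phi>) = N (sem V N \<phi>)"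

text \<open>Truth at a fixed world is a valuation of the propositional atoms, which yields soundness
  for tautologies.\<close>

lemma sem_eq_prop_eval: "sem V N \<phi> w = prop_eval (\<lambda>\<psi>. sem V N \<psi> w) \<phi>"
  by (induction \<phi>) auto

lemma sem_subst: "sem V N (subst s \<phi>) = sem (\<lambda>x. sem V N (s x)) N \<phi>"
  by (induction \<phi>) auto

lemma soundness: "\<phi> \<in> E \<Longrightarrow> sem V N \<phi> w"
\<comment> \<open>\<open>V\<close> varies because US changes the valuation, \<open>w\<close> because
  RE needs equal truth at all worlds.\<close>
proof (induction arbitrary: V w rule: E.induct)
  case (taut \<phi>)
  then show ?case by (simp add: sem_eq_prop_eval[of V N \<phi>] tautology_def)
next
  case (RE \<phi> \<psi>)
  then have "sem V N \<phi> = sem V N \<psi>" by fastforce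
  then show ?case by simp
qed (auto simp: sem_subst)

lemma E_equiv_sem: "\<phi> \<approx> \<psi> \<Longrightarrow> sem V N \<phi> = sem V N \<psi>"
  unfolding E_equiv_def using soundness[of "Iff \<phi> \<psi>" V N] by fastforce

section \<open>Congruence rules for provable equivalence\<close>

lemma E_taut_MP: "tautology (Imp \<phi> \<psi>) \<Longrightarrow> \<phi> \<in> E \<Longrightarrow> \<psi> \<in> E"
  by (blast intro: E.intros)

lemma E_taut_MP2: "tautology (Imp \<phi> (Imp \<psi> \<chi>)) \<Longrightarrow> \<phi> \<in> E \<Longrightarrow> \<psi> \<in> E \<Longrightarrow> \<chi> \<in> E"
  by (blast intro: E.intros)

lemma E_equiv_taut: "tautology (Iff \<phi> \<psi>) \<Longrightarrow> \<phi> \<approx> \<psi>"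
  by (simp add: E_equiv_def E.taut)

lemma E_equiv_refl [simp]: "\<phi> \<approx> \<phi>"
  by (rule E_equiv_taut) (simp add: tautology_def)

lemma E_equiv_sym: "\<phi> \<approx> \<psi> \<Longrightarrow> \<psi> \<approx> \<phi>"
  unfolding E_equiv_def by (erule E_taut_MP[rotated]) (auto simp: tautology_def)

lemma E_equiv_trans [trans]: "\<phi> \<approx> \<psi> \<Longrightarrow> \<psi> \<approx> \<chi> \<Longrightarrow> \<phi> \<approx> \<chi>"
  unfolding E_equiv_def by (erule (1) E_taut_MP2[rotated]) (auto simp: tautology_def)

lemma E_equiv_Neg: "\<phi> \<approx> \<psi> \<Longrightarrow> Neg \<phi> \<approx> Neg \<psi>"
  unfolding E_equiv_def by (erule E_taut_MP[rotated]) (auto simp: tautology_def)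

lemma E_equiv_Or: "\<phi> \<approx> \<psi> \<Longrightarrow> \<phi>' \<approx> \<psi>' \<Longrightarrow> Or \<phi> \<phi>' \<approx> Or \<psi> \<psi>'"
  unfolding E_equiv_def by (erule (1) E_taut_MP2[rotated]) (auto simp: tautology_def)

lemma E_equiv_Dia: "\<phi> \<approx> \<psi> \<Longrightarrow> Dia \<phi> \<approx> Dia \<psi>"
  by (simp add: E_equiv_def E.RE)

lemma E_equiv_subst: "\<phi> \<approx> \<psi> \<Longrightarrow> subst s \<phi> \<approx> subst s \<psi>"
  unfolding E_equiv_def by (drule E.US[of _ s]) simp

section \<open>Compatibility of composition with equivalence\<close>

lemma subst_cong: "(\<And>x. x \<in> vars \<phi> \<Longrightarrow> s x = s' x) \<Longrightarrow> subst s \<phi> = subst s' \<phi>"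
  by (induction \<phi>) auto

lemma subst_subst: "subst s (subst s' \<phi>) = subst (\<lambda>x. subst s (s' x)) \<phi>"
  by (induction \<phi>) auto

lemma subst_inst:
  assumes "vars \<rho> \<subseteq> {e_idx}"
  shows "subst s (inst \<rho> \<psi>) = inst \<rho> (subst s \<psi>)"
  unfolding inst_def subst_subst by (rule subst_cong) (use assms in auto)

text \<open>The only variable of a replacement is \<open>e\<close>, which \<open>inst\<close> fills,
  so outer substitutions pass through it. This handles US in \<open>E_star\<close>.\<close>

lemma star_subst:
  assumes "vars \<rho> \<subseteq> {e_idx}"
  shows "subst s \<phi> \<star> \<rho> = subst (\<lambda>x. s x \<star> \<rho>) (\<phi> \<star> \<rho>)"
  by (induction \<phi>) (auto simp: subst_inst[OF assms])

lemma subst_E_equiv: "(\<And>x. s x \<approx> s' x) \<Longrightarrow> subst s \<phi> \<approx> subst s' \<phi>"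
  by (induction \<phi>) (auto intro: E_equiv_Neg E_equiv_Or E_equiv_Dia)

lemma inst_E_equiv: "\<rho> \<approx> \<rho>' \<Longrightarrow> \<psi> \<approx> \<psi>' \<Longrightarrow> inst \<rho> \<psi> \<approx> inst \<rho>' \<psi>'"
  unfolding inst_def
  by (rule E_equiv_trans[OF E_equiv_subst subst_E_equiv]) auto

text \<open>Star commutes with the Boolean connectives and only revalues modal atoms, so tautologies
  stay tautologies.\<close>

lemma prop_eval_star: "prop_eval v (\<phi> \<star> \<rho>) = prop_eval (\<lambda>\<psi>. prop_eval v (\<psi> \<star> \<rho>)) \<phi>"
  by (induction \<phi>) auto

text \<open>Makes composition respect equivalence on the left. RE survives because equivalent
  formulas put into \<open>\<rho>\<close> give equivalent results.\<close>

lemma E_star: "\<phi> \<in> E \<Longrightarrow> vars \<rho> \<subseteq> {e_idx} \<Longrightarrow> \<phi> \<star> \<rho> \<in> E"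
proof (induction rule: E.induct)
  case (taut \<phi>)
  then show ?case
    by (auto intro: E.taut simp: tautology_def prop_eval_star[of _ \<phi>])
next
  case (MP \<phi> \<psi>)
  then show ?case by (auto intro: E.MP)
next
  case (US \<phi> s)
  then show ?case by (simp add: star_subst E.US)
next
  case (RE \<phi> \<psi>)
  then have "\<phi> \<star> \<rho> \<approx> \<psi> \<star> \<rho>" by (simp add: E_equiv_def)
  then have "inst \<rho> (\<phi> \<star> \<rho>) \<approx> inst \<rho> (\<psi> \<star> \<rho>)" by (simp add: inst_E_equiv)
  then show ?case by (simp add: E_equiv_def)
qed

lemma star_E_equiv_right: "\<rho> \<approx> \<rho>' \<Longrightarrow> \<phi> \<star> \<rho> \<approx> \<phi> \<star> \<rho>'"
  by (induction \<phi>) (auto intro: E_equiv_Neg E_equiv_Or inst_E_equiv)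

lemma star_E_equiv:
  assumes "\<phi> \<approx> \<psi>" "\<rho> \<approx> \<rho>'" "vars \<rho> \<subseteq> {e_idx}"
  shows "\<phi> \<star> \<rho> \<approx> \<psi> \<star> \<rho>'"
proof -
  have "\<phi> \<star> \<rho> \<approx> \<psi> \<star> \<rho>"
    using E_star[OF _ assms(3)] assms(1) by (fastforce simp: E_equiv_def)
  also have "\<psi> \<star> \<rho> \<approx> \<psi> \<star> \<rho>'" using assms(2) by (rule star_E_equiv_right)
  finally show ?thesis .
qed

lemma vars_inst: "vars (inst \<rho> \<psi>) \<subseteq> (vars \<rho> - {e_idx}) \<union> vars \<psi>"
  unfolding inst_def by (induction \<rho>) auto

lemma vars_star: "vars \<rho> \<subseteq> {e_idx} \<Longrightarrow> vars (\<phi> \<star> \<rho>) \<subseteq> vars \<phi>"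
proof (induction \<phi>)
  case (Dia \<phi>)
  then show ?case using vars_inst[of \<rho> "\<phi> \<star> \<rho>"] by auto
qed auto

lemma modal_degree_inst: "modal_degree (inst \<rho> \<psi>) \<le> modal_degree \<rho> + modal_degree \<psi>"
  unfolding inst_def by (induction \<rho>) auto

lemma modal_degree_star: "modal_degree \<rho> \<le> 1 \<Longrightarrow> modal_degree (\<phi> \<star> \<rho>) \<le> modal_degree \<phi>"
proof (induction \<phi>)
  case (Dia \<phi>)
  then show ?case using modal_degree_inst[of \<rho> "\<phi> \<star> \<rho>"] by auto
qed auto

lemma star_UR: "\<rho> \<in> UR \<Longrightarrow> \<rho>' \<in> UR \<Longrightarrow> \<rho> \<star> \<rho>' \<in> UR"
  unfolding UR_def using modal_degree_star[of \<rho>' \<rho>] vars_star[of \<rho>' \<rho>] by auto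

section \<open>Action on the subsets of two worlds\<close>

text \<open>
  At \<open>g = id\<close> this is \<open>p\<close>, at \<open>g = Not\<close> it is \<open>p\<close> with the worlds exchanged,
  and at constant \<open>g\<close> it is empty.
\<close>

definition nbhd :: "(bool \<Rightarrow> bool) \<Rightarrow> (bool \<Rightarrow> bool) \<Rightarrow> bool \<Rightarrow> bool" where
  "nbhd p g w \<longleftrightarrow> g True \<noteq> g False \<and> p (g True = w)"

definition act :: "fm \<Rightarrow> (bool \<Rightarrow> bool) \<Rightarrow> bool \<Rightarrow> bool" where
  "act \<rho> p = sem (\<lambda>_ w. w) (nbhd p) \<rho>"

lemma act_simps [simp]:
  "act (Var x) p = (\<lambda>w. w)"
  "act Zero p = (\<lambda>w. False)"
  "act One p = (\<lambda>w. True)"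
  "act (Neg \<phi>) p = (\<lambda>w. \<not> act \<phi> p w)"
  "act (Or \<phi> \<psi>) p = (\<lambda>w. act \<phi> p w \<or> act \<psi> p w)"
  "act (Dia \<phi>) p = nbhd p (act \<phi> p)"
  by (simp_all add: act_def)

lemma nbhd_id [simp]: "nbhd p (\<lambda>w. w) = p"
  by (simp add: nbhd_def fun_eq_iff)

lemma nbhd_Not [simp]: "nbhd p Not = (\<lambda>w. p (\<not> w))"
  by (simp add: nbhd_def fun_eq_iff)

lemma E_equiv_act: "\<phi> \<approx> \<psi> \<Longrightarrow> act \<phi> = act \<psi>"
  by (simp add: act_def fun_eq_iff E_equiv_sem)

lemma nbhd_flip: "nbhd p (\<lambda>w. g (\<not> w)) w = nbhd p g (\<not> w)"
  by (cases w; cases "g True"; cases "g False"; simp add: nbhd_def)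

text \<open>Substituting \<open>Neg e\<close> exchanges the worlds in the valuation, and the model
  is symmetric under this exchange.\<close>

lemma act_inst_Neg:
  "vars \<rho> \<subseteq> {e_idx} \<Longrightarrow> act (inst \<rho> (Neg e)) p = (\<lambda>w. act \<rho> p (\<not> w))"
  unfolding inst_def by (induction \<rho>) (auto simp: nbhd_flip)

section \<open>Boolean combinations of three atoms\<close>

text \<open>\<open>Dia Zero\<close> and \<open>Dia One\<close> are left out: both have empty truth
  set in these models, so equal actions would not imply equivalence.\<close>

inductive_set basic :: "fm set" where
  "e \<in> basic"
| "Zero \<in> basic"
| "One \<in> basic"
| "\<phi> \<in> basic \<Longrightarrow> Neg \<phi> \<in> basic"
| "\<phi> \<in> basic \<Longrightarrow> \<psi> \<in> basic \<Longrightarrow> Or \<phi> \<psi> \<in> basic"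
| "Dia e \<in> basic"
| "Dia (Neg e) \<in> basic"

lemma vars_basic: "\<phi> \<in> basic \<Longrightarrow> vars \<phi> \<subseteq> {e_idx}"
  by (induction rule: basic.induct) auto

lemma inst_e: "inst \<rho> e = \<rho>"
  unfolding inst_def by (induction \<rho>) auto

lemma Neg_Neg_E_equiv: "Neg (Neg \<phi>) \<approx> \<phi>"
  by (rule E_equiv_taut) (simp add: tautology_def)

lemma inst_Neg_basic: "\<rho> \<in> basic \<Longrightarrow> \<exists>\<chi>\<in>basic. inst \<rho> (Neg e) \<approx> \<chi>"
proof (induction rule: basic.induct)
  case 7
  \<comment> \<open>RE cancels the double negation, so the two modal atoms trade places.\<close>
  have "inst (Dia (Neg e)) (Neg e) \<approx> Dia e"
    by (simp add: inst_def E_equiv_Dia Neg_Neg_E_equiv)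
  then show ?case by (blast intro: basic.intros)
next
  case (4 \<phi>)
  then obtain \<chi> where "\<chi> \<in> basic" "inst \<phi> (Neg e) \<approx> \<chi>" by blast
  then show ?case
    by (intro bexI[of _ "Neg \<chi>"]) (auto simp: inst_def intro: basic.intros E_equiv_Neg)
next
  case (5 \<phi> \<psi>)
  then obtain \<chi> \<chi>' where "\<chi> \<in> basic" "inst \<phi> (Neg e) \<approx> \<chi>" "\<chi>' \<in> basic" "inst \<psi> (Neg e) \<approx> \<chi>'"
    by blast
  then show ?case
    by (intro bexI[of _ "Or \<chi> \<chi>'"]) (auto simp: inst_def intro: basic.intros E_equiv_Or)
qed (auto simp: inst_def intro: basic.intros E_equiv_refl)

text \<open>Composition puts \<open>\<rho>\<close> for \<open>Dia e\<close> and
  \<open>inst \<rho> (Neg e)\<close> for \<open>Dia (Neg e)\<close>; both are basic up to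
  equivalence.\<close>

lemma star_basic: "\<phi> \<in> basic \<Longrightarrow> \<rho> \<in> basic \<Longrightarrow> \<exists>\<chi>\<in>basic. \<phi> \<star> \<rho> \<approx> \<chi>"
proof (induction rule: basic.induct)
  case (4 \<phi>)
  then obtain \<chi> where "\<chi> \<in> basic" "\<phi> \<star> \<rho> \<approx> \<chi>" by blast
  then show ?case
    by (intro bexI[of _ "Neg \<chi>"]) (auto intro: basic.intros E_equiv_Neg)
next
  case (5 \<phi> \<psi>)
  then obtain \<chi> \<chi>' where "\<chi> \<in> basic" "\<phi> \<star> \<rho> \<approx> \<chi>" "\<chi>' \<in> basic" "\<psi> \<star> \<rho> \<approx> \<chi>'"
    by blast
  then show ?case
    by (intro bexI[of _ "Or \<chi> \<chi>'"]) (auto intro: basic.intros E_equiv_Or)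
next
  case 7
  then show ?case by (simp add: inst_Neg_basic)
qed (auto simp: inst_e intro: basic.intros E_equiv_refl)

text \<open>The formulas put for the two modal atoms have truth sets \<open>act \<rho> p\<close> and
  its mirror image, which are those of the atoms in the model given by
  \<open>act \<rho> p\<close>.\<close>

lemma act_star:
  assumes "\<phi> \<in> basic" "vars \<rho> \<subseteq> {e_idx}"
  shows "act (\<phi> \<star> \<rho>) p = act \<phi> (act \<rho> p)"
  using assms(1)
  by (induction rule: basic.induct) (auto simp: inst_e act_inst_Neg[OF assms(2)])

text \<open>
  The atoms \<open>e\<close>, \<open>\<lozenge>e\<close>, \<open>\<lozenge>\<not>e\<close> take any prescribed truth values at
  a suitable world of a suitable model.
\<close>

lemma prop_eval_basic:
  assumes "\<phi> \<in> basic"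
  shows "prop_eval v \<phi> = act \<phi> (\<lambda>w. if w = v e then v (Dia e) else v (Dia (Neg e))) (v e)"
  using assms by (induction rule: basic.induct) auto

text \<open>Equal actions give equal values under every valuation, so the equivalence is already a
  tautology.\<close>

lemma basic_E_equivI:
  assumes "\<phi> \<in> basic" "\<psi> \<in> basic" "act \<phi> = act \<psi>"
  shows "\<phi> \<approx> \<psi>"
  by (rule E_equiv_taut) (use assms in \<open>simp add: tautology_def prop_eval_basic\<close>)

lemma Rp1_basic: "Rp1 \<subseteq> basic"
  by (auto simp: Rp1_def intro!: basic.intros)

section \<open>The 24 replacements as permutations\<close>

lemma bool_fun_eq_iff: "p = q \<longleftrightarrow> p True = q True \<and> p False = q False" for p q :: "bool \<Rightarrow> 'a"
  by (metis (full_types) ext)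

text \<open>Explicit finite images allow enumeration by simplification.\<close>

lemma Rp1_eq:
  "Rp1 =
    (\<Union>l\<in>{Dia e, Neg (Dia e)}. Iff l `
      {One, e, Or e (Dia (Neg e)), Or e (Neg (Dia (Neg e))),
       Or (Neg e) (Dia (Neg e)), Or (Neg e) (Neg (Dia (Neg e)))}) \<union>
    (\<Union>l\<in>{Dia (Neg e), Neg (Dia (Neg e))}. Iff l `
      {One, e, Or e (Dia e), Or e (Neg (Dia e)), Or (Neg e) (Dia e), Or (Neg e) (Neg (Dia e))})"
proof -
  have "{Iff l t | l t. l \<in> L \<and> t \<in> T} = (\<Union>l\<in>L. Iff l ` T)" for L T
    by blast
  then show ?thesis unfolding Rp1_def by (simp only:)
qed

definition bool_funs :: "(bool \<Rightarrow> bool) list" where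
  "bool_funs = [\<lambda>w. False, \<lambda>w. \<not> w, \<lambda>w. w, \<lambda>w. True]"

lemma set_bool_funs: "set bool_funs = UNIV"
  by (auto simp: bool_funs_def bool_fun_eq_iff)

lemma act_permutes:
  assumes "\<rho> \<in> Rp1"
  shows "act \<rho> permutes UNIV"
proof -
  \<comment> \<open>Checked member by member: the four subsets have distinct images.\<close>
  have "\<forall>\<rho>\<in>Rp1. distinct (map (act \<rho>) bool_funs)"
    by (simp add: Rp1_eq bool_funs_def bool_fun_eq_iff)
  then have "inj (act \<rho>)"
    using assms by (simp add: distinct_map set_bool_funs)
  then show ?thesis
    by (intro bij_imp_permutes) (auto simp: bij_def finite_UNIV_inj_surj)
qed

lemma inj_on_act: "inj_on act Rp1"
proof -
  \<comment> \<open>Tables of truth values can be compared by evaluation; finding 24 distinct ones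
    for 24 formulas forces injectivity.\<close>
  let ?T = "\<lambda>\<rho>. map (\<lambda>p. (act \<rho> p True, act \<rho> p False)) bool_funs"
  have "card (?T ` Rp1) = card Rp1"
    unfolding card_Rp1 by (simp add: Rp1_eq bool_funs_def image_Un)
  then have "inj_on ?T Rp1"
    by (rule eq_card_imp_inj_on[rotated]) (use card_Rp1 card_gt_0_iff[of Rp1] in simp)
  then show ?thesis
    by (auto simp: inj_on_def)
qed

text \<open>24 distinct permutations of a four-element set exhaust all \<open>fact 4\<close> of
  them.\<close>

lemma act_image_Rp1: "act ` Rp1 = {\<pi>. \<pi> permutes UNIV}"
proof (rule card_subset_eq)
  show "act ` Rp1 \<subseteq> {\<pi>. \<pi> permutes UNIV}" using act_permutes by blast
  have "CARD(bool \<Rightarrow> bool) = 4" by (simp add: card_fun)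
  then have "card {\<pi>. \<pi> permutes (UNIV :: (bool \<Rightarrow> bool) set)} = fact 4"
    by (rule card_permutations) simp
  then show "card (act ` Rp1) = card {\<pi>. \<pi> permutes (UNIV :: (bool \<Rightarrow> bool) set)}"
    by (simp add: card_image[OF inj_on_act] card_Rp1 fact_numeral)
qed simp

text \<open>No composition table is computed: the composed action is a permutation, hence that of
  some member, and basic formulas with equal actions are equivalent.\<close>

lemma Rp1_star_closed:
  assumes "\<rho> \<in> Rp1" "\<rho>' \<in> Rp1"
  obtains \<sigma> where "\<sigma> \<in> Rp1" "\<rho> \<star> \<rho>' \<approx> \<sigma>" "act \<sigma> = act \<rho> \<circ> act \<rho>'"
proof -
  have basic: "\<rho> \<in> basic" "\<rho>' \<in> basic" using assms Rp1_basic by auto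
  obtain \<chi> where \<chi>: "\<chi> \<in> basic" "\<rho> \<star> \<rho>' \<approx> \<chi>" using star_basic[OF basic] by blast
  have act: "act (\<rho> \<star> \<rho>') = act \<rho> \<circ> act \<rho>'"
    using act_star[OF basic(1) vars_basic[OF basic(2)]] by (simp add: fun_eq_iff)
  have "act \<rho> \<circ> act \<rho>' \<in> act ` Rp1"
    using assms by (simp add: act_image_Rp1 act_permutes permutes_compose)
  then obtain \<sigma> where \<sigma>: "\<sigma> \<in> Rp1" "act \<sigma> = act \<rho> \<circ> act \<rho>'" by force
  have "\<chi> \<approx> \<sigma>"
    using \<chi> \<sigma> Rp1_basic act E_equiv_act[OF \<chi>(2)] by (intro basic_E_equivI) auto
  with \<chi>(2) have "\<rho> \<star> \<rho>' \<approx> \<sigma>" by (rule E_equiv_trans)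
  with \<sigma> show ?thesis using that by blast
qed

section \<open>The group of classes and its isomorphism\<close>

lemma equiv_UR_rel: "equiv UR UR_rel"
  by (auto simp: equiv_def refl_on_def sym_def trans_def UR_rel_def
      intro: E_equiv_sym E_equiv_trans)

text \<open>As composition respects equivalence, the union defining \<open>mult\<close> collapses to
  one class.\<close>

lemma Rp1_group_mult:
  assumes "\<rho> \<in> UR" "\<rho>' \<in> UR"
  shows "UR_rel `` {\<rho>} \<otimes>\<^bsub>Rp1_group\<^esub> UR_rel `` {\<rho>'} = UR_rel `` {\<rho> \<star> \<rho>'}"
proof -
  have "congruent2 UR_rel UR_rel (\<lambda>\<rho> \<rho>'. UR_rel `` {\<rho> \<star> \<rho>'})"
  proof (rule congruent2I')
    fix \<rho> \<sigma> \<rho>' \<sigma>'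
    assume "(\<rho>, \<sigma>) \<in> UR_rel" "(\<rho>', \<sigma>') \<in> UR_rel"
    then have "(\<rho> \<star> \<rho>', \<sigma> \<star> \<sigma>') \<in> UR_rel"
      using star_E_equiv[of \<rho> \<sigma> \<rho>' \<sigma>'] star_UR by (auto simp: UR_rel_def) (auto simp: UR_def)
    then show "UR_rel `` {\<rho> \<star> \<rho>'} = UR_rel `` {\<sigma> \<star> \<sigma>'}"
      by (rule equiv_class_eq[OF equiv_UR_rel])
  qed
  then show ?thesis
    using UN_equiv_class2[OF equiv_UR_rel equiv_UR_rel _ assms] by (simp add: Rp1_group_def)
qed

text \<open>The choice of representative is harmless, since equivalent formulas act alike.\<close>

definition class_act :: "fm set \<Rightarrow> (bool \<Rightarrow> bool) \<Rightarrow> bool \<Rightarrow> bool" where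
  "class_act A = act (SOME \<rho>. \<rho> \<in> A)"

lemma class_act:
  assumes "\<rho> \<in> UR"
  shows "class_act (UR_rel `` {\<rho>}) = act \<rho>"
proof -
  have "\<rho> \<in> UR_rel `` {\<rho>}" using assms by (simp add: UR_rel_def)
  then have "(SOME \<sigma>. \<sigma> \<in> UR_rel `` {\<rho>}) \<in> UR_rel `` {\<rho>}" by (rule someI)
  then show ?thesis
    unfolding class_act_def by (auto simp: UR_rel_def dest: E_equiv_act)
qed

lemma carrier_Rp1_group: "carrier Rp1_group = (\<lambda>\<rho>. UR_rel `` {\<rho>}) ` Rp1"
  by (auto simp: Rp1_group_def quotient_def)

lemma bij_betw_class_act: "bij_betw class_act (carrier Rp1_group) {\<pi>. \<pi> permutes UNIV}"
proof -
  have eq: "class_act (UR_rel `` {\<rho>}) = act \<rho>" if "\<rho> \<in> Rp1" for \<rho>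
    using that Rp1_subset_UR by (auto intro: class_act)
  have "inj_on class_act (carrier Rp1_group)"
    by (rule inj_onI) (auto simp: carrier_Rp1_group eq dest: inj_onD[OF inj_on_act])
  moreover have "class_act ` carrier Rp1_group = act ` Rp1"
    by (simp add: carrier_Rp1_group image_image eq)
  ultimately show ?thesis by (simp add: bij_betw_def act_image_Rp1)
qed

lemma class_act_mult:
  assumes "A \<in> carrier Rp1_group" "B \<in> carrier Rp1_group"
  shows "A \<otimes>\<^bsub>Rp1_group\<^esub> B \<in> carrier Rp1_group"
    and "class_act (A \<otimes>\<^bsub>Rp1_group\<^esub> B) = class_act A \<circ> class_act B"
proof -
  obtain \<rho> \<rho>' where *: "\<rho> \<in> Rp1" "\<rho>' \<in> Rp1" "A = UR_rel `` {\<rho>}" "B = UR_rel `` {\<rho>'}"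
    using assms by (auto simp: carrier_Rp1_group)
  obtain \<sigma> where \<sigma>: "\<sigma> \<in> Rp1" "\<rho> \<star> \<rho>' \<approx> \<sigma>" "act \<sigma> = act \<rho> \<circ> act \<rho>'"
    using Rp1_star_closed *(1,2) by blast
  have UR: "\<rho> \<in> UR" "\<rho>' \<in> UR" "\<sigma> \<in> UR" using * \<sigma> Rp1_subset_UR by auto
  have "UR_rel `` {\<rho> \<star> \<rho>'} = UR_rel `` {\<sigma>}"
    using UR \<sigma> star_UR by (intro equiv_class_eq[OF equiv_UR_rel]) (auto simp: UR_rel_def)
  then have prod: "A \<otimes>\<^bsub>Rp1_group\<^esub> B = UR_rel `` {\<sigma>}"
    using Rp1_group_mult UR * by simp
  show "A \<otimes>\<^bsub>Rp1_group\<^esub> B \<in> carrier Rp1_group"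
    using prod \<sigma> by (simp add: carrier_Rp1_group)
  show "class_act (A \<otimes>\<^bsub>Rp1_group\<^esub> B) = class_act A \<circ> class_act B"
    unfolding prod using UR * \<sigma> by (simp add: class_act)
qed

lemma Rp1_group_one: "\<one>\<^bsub>Rp1_group\<^esub> \<in> carrier Rp1_group" "class_act \<one>\<^bsub>Rp1_group\<^esub> = id"
proof -
  \<comment> \<open>\<open>Dia e\<close> is not itself in \<open>Rp1\<close>; this member represents
    its class.\<close>
  have "UR_rel `` {Iff (Dia e) One} = UR_rel `` {Dia e}"
    by (intro equiv_class_eq[OF equiv_UR_rel])
      (auto simp: UR_rel_def UR_def tautology_def intro: E_equiv_taut)
  moreover have "Iff (Dia e) One \<in> Rp1" by (auto simp: Rp1_def)
  ultimately show "\<one>\<^bsub>Rp1_group\<^esub> \<in> carrier Rp1_group"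
    by (auto simp: carrier_Rp1_group) (auto simp: Rp1_group_def)
  have "class_act (UR_rel `` {Dia e}) = act (Dia e)"
    by (rule class_act) (simp add: UR_def)
  then show "class_act \<one>\<^bsub>Rp1_group\<^esub> = id"
    by (simp add: Rp1_group_def fun_eq_iff)
qed

theorem theorem11:
  shows "group Rp1_group \<and> Rp1_group \<cong> sym_group 4"
proof -
  have "card {1..4::nat} = CARD(bool \<Rightarrow> bool)" by (simp add: card_fun)
  then obtain f :: "(bool \<Rightarrow> bool) \<Rightarrow> nat" where f: "bij_betw f UNIV {1..4}"
    using finite_same_card_bij[of "UNIV :: (bool \<Rightarrow> bool) set" "{1..4::nat}"] by auto
  \<comment> \<open>Conjugation by the numbering \<open>f\<close>, extended by the identity because
    \<open>sym_group 4\<close> consists of maps on all naturals that fix everything outside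
    \<open>{1..4}\<close>.\<close>
  define c where "c = (\<lambda>\<pi> x. if x \<in> {1..4} then f (\<pi> (inv_into UNIV f x)) else x)"
  have c: "bij_betw c {\<pi>. \<pi> permutes UNIV} (carrier (sym_group 4))"
    unfolding c_def sym_group_def using bij_betw_permutations[OF f] by simp
  have c_comp: "c (\<pi> \<circ> \<pi>') = c \<pi> \<circ> c \<pi>'" for \<pi> \<pi>'
    using bij_betwE[OF f] bij_betw_inv_into_left[OF f] by (intro ext) (auto simp: c_def)
  have "c \<circ> class_act \<in> iso Rp1_group (sym_group 4)"
  proof (rule isoI)
    show bij: "bij_betw (c \<circ> class_act) (carrier Rp1_group) (carrier (sym_group 4))"
      using bij_betw_class_act c by (rule bij_betw_trans)
    show "c \<circ> class_act \<in> hom Rp1_group (sym_group 4)"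
      using bij_betwE[OF bij] by (auto simp: hom_def class_act_mult c_comp sym_group_def)
  qed
  then have iso: "Rp1_group \<cong> sym_group 4" by (auto simp: is_iso_def)
  have "group Rp1_group"
  proof (rule groupI)
    \<comment> \<open>As \<open>class_act\<close> is injective and multiplicative, the group laws
      are inherited from permutations.\<close>
    note inj = inj_onD[OF bij_betw_imp_inj_on[OF bij_betw_class_act]]
    fix x y z
    assume x: "x \<in> carrier Rp1_group"
    show "\<one>\<^bsub>Rp1_group\<^esub> \<otimes>\<^bsub>Rp1_group\<^esub> x = x"
      using x by (simp add: inj class_act_mult Rp1_group_one)
    have "class_act x permutes UNIV"
      using x bij_betwE[OF bij_betw_class_act] by blast
    then have perm: "inv' (class_act x) permutes UNIV" "inv' (class_act x) \<circ> class_act x = id"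
      by (simp_all add: permutes_inv permutes_inv_o)
    \<comment> \<open>Surjectivity of \<open>class_act\<close> supplies a class acting as the
      inverse permutation.\<close>
    then obtain x' where "x' \<in> carrier Rp1_group" "class_act x' = inv' (class_act x)"
      using bij_betw_imp_surj_on[OF bij_betw_class_act] by (metis imageE mem_Collect_eq)
    then show "\<exists>y\<in>carrier Rp1_group. y \<otimes>\<^bsub>Rp1_group\<^esub> x = \<one>\<^bsub>Rp1_group\<^esub>"
      using x perm by (intro bexI[of _ x']) (simp_all add: inj class_act_mult Rp1_group_one)
    assume "y \<in> carrier Rp1_group" "z \<in> carrier Rp1_group"
    with x show "x \<otimes>\<^bsub>Rp1_group\<^esub> y \<otimes>\<^bsub>Rp1_group\<^esub> z = x \<otimes>\<^bsub>Rp1_group\<^esub> (y \<otimes>\<^bsub>Rp1_group\<^esub> z)"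
      by (simp add: inj class_act_mult o_assoc)
  qed (simp_all add: class_act_mult Rp1_group_one)
  with iso show ?thesis by blast
qed

end
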